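(* Let $\delta>0$ and $$\Lambda_\delta=\bigcup_{n=1}^\infty\Big\{\big(x,\tfrac{\delta x}{n}\big):x\in\mathbb{R}\Big\}\cup\bigcup_{n=1}^\infty\Big\{\big(x,-\tfrac{\delta x}{n}\big):x\in\mathbb{R}\Big\}\subset\mathbb{R}^2 .$$ Then $\Lambda_\delta$ has property (vi) with respect to $\delta$ for $j=1$, and $\Lambda_\delta$ does not have weak locally finite $\mathcal{H}^1$ measure. Consequently property (vi) does not imply weak locally finite $\mathcal{H}^j$ measure.
   Context: Property (vi) (strong $j$-dimensional $\delta$-approximation property) for $A\subset\mathbb{R}^n$ and $\delta>0$: for each $y\in A$ there are a $j$-dimensional affine space $L_y$ containing $y$ and $\rho_y>0$ such that $B_\rho(y)\cap A\subset L_y^{\delta\rho}$ for every $\rho\in(0,\rho_y]$, where $L^s:=\{x:|x-z|<s\text{ for some }z\in L\}$ and $B_\rho(y)$ is the open ball. A set $A$ has weak locally finite $\mathcal{H}^j$ measure ($\mathcal{H}^j$ being $j$-dimensional Hausdorff measure) if for each $y\in A$ there is $\rho_y>0$ with $\mathcal{H}^j(B_{\rho_y}(y)\cap A)<\infty$. *)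

theory Defs
  imports "HOL-Analysis.Analysis"
begin

definition nbhd :: "'a::real_normed_vector set \<Rightarrow> real \<Rightarrow> 'a set" where
  "nbhd L s = {x. \<exists>z\<in>L. norm (x - z) < s}"

(* The approximating plane L may depend on y but not on the scale \<rho>. *)
definition strong_approx_property ::
  "nat \<Rightarrow> real \<Rightarrow> 'a::euclidean_space set \<Rightarrow> bool" where
  "strong_approx_property j \<delta> A \<longleftrightarrow>
     (\<forall>y\<in>A. \<exists>L \<rho>\<^sub>y. affine L \<and> aff_dim L = int j \<and> y \<in> L \<and> \<rho>\<^sub>y > 0 \<and>
        (\<forall>\<rho>\<in>{0<..\<rho>\<^sub>y}. ball y \<rho> \<inter> A \<subseteq> nbhd L (\<delta> * \<rho>)))"

(* The standard normalization: \<omega>_j (diam C / 2)^j, with \<omega>_j the volume of the unit ball of R^j.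
   The empty set is given weight 0 separately because 0 ^ 0 = 1 when j = 0. *)
definition hausdorff_weight :: "nat \<Rightarrow> 'a::metric_space set \<Rightarrow> ennreal" where
  "hausdorff_weight j C =
     (if C = {} then 0 else ennreal (unit_ball_vol (real j) * (diameter C / 2) ^ j))"

(* Boundedness is required explicitly because diameter is meaningful only for bounded sets.
   Finite covers are included, as the C i may be empty. *)
definition hausdorff_premeasure ::
  "nat \<Rightarrow> real \<Rightarrow> 'a::metric_space set \<Rightarrow> ennreal" where
  "hausdorff_premeasure j d A =
     (INF C \<in> {C :: nat \<Rightarrow> 'a set. A \<subseteq> (\<Union>i. C i) \<and> (\<forall>i. bounded (C i) \<and> diameter (C i) \<le> d)}.
        \<Sum>i. hausdorff_weight j (C i))"

definition hausdorff_measure :: "nat \<Rightarrow> 'a::metric_space set \<Rightarrow> ennreal" where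
  "hausdorff_measure j A = (SUP d \<in> {0<..}. hausdorff_premeasure j d A)"

definition weak_locally_finite_hausdorff :: "nat \<Rightarrow> 'a::metric_space set \<Rightarrow> bool" where
  "weak_locally_finite_hausdorff j A \<longleftrightarrow>
     (\<forall>y\<in>A. \<exists>\<rho>>0. hausdorff_measure j (ball y \<rho> \<inter> A) < \<infinity>)"

definition Lambda :: "real \<Rightarrow> (real^2) set" where
  "Lambda \<delta> =
     (\<Union>n\<in>{1::nat..}. {vector [x, \<delta> * x / real n] | x. x \<in> (UNIV :: real set)}) \<union>
     (\<Union>n\<in>{1::nat..}. {vector [x, - (\<delta> * x / real n)] | x. x \<in> (UNIV :: real set)})"

end

theory Submission
  imports Defs
begin

text \<open>
  The set consists of the lines \<open>m y = \<delta> x\<close> for nonzero integers \<open>m\<close>. At the origin the horizontal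
  axis approximates it, since \<open>\<bar>y\<bar> \<le> \<delta> \<bar>x\<bar>\<close> on each line; near any other point it coincides with
  a single line. For the measure, restrict to the pieces \<open>c / 2 \<le> x < c\<close> of the lines
  \<open>m = 1, \<dots>, N\<close>. These are separated by a positive distance, so placing their projections to the
  first axis end to end is a map to an interval of length \<open>N c / 2\<close> which does not increase small
  distances. Hence the Hausdorff measure of every ball around the origin is at least \<open>N c / 2\<close>
  for all \<open>N\<close>.
\<close>

section \<open>Comparing Hausdorff measure with Lebesgue measure on the real line\<close>

lemma hausdorff_weight_1:
  "hausdorff_weight 1 C = (if C = {} then 0 else ennreal (diameter C))"
  by (simp add: hausdorff_weight_def unit_ball_vol_1)

text \<open>The interval runs from the infimum to the supremum of the image. In the application
  \<open>C\<close> is a member of a cover and \<open>S\<close> the set on which \<open>f\<close> is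
  controlled.\<close>

lemma image_subset_interval_diameter:
  fixes f :: "'a::metric_space \<Rightarrow> real"
  assumes "bounded C" "C \<noteq> {}"
    and f: "\<And>p q. p \<in> C \<inter> S \<Longrightarrow> q \<in> C \<inter> S \<Longrightarrow> \<bar>f p - f q\<bar> \<le> dist p q"
  obtains a b where "f ` (C \<inter> S) \<subseteq> {a..b}" "a \<le> b" "b - a \<le> diameter C"
proof (cases "C \<inter> S = {}")
  case True
  have "0 \<le> diameter C" using assms(1) by (rule diameter_ge_0)
  then show ?thesis using that[of 0 0] True by auto
next
  case False
  define F where "F = f ` (C \<inter> S)"
  have ne: "F \<noteq> {}" using False by (auto simp: F_def)
  have *: "u - v \<le> diameter C" if uv: "u \<in> F" "v \<in> F" for u v
  proof -
    obtain p where p: "p \<in> C \<inter> S" "u = f p" using uv(1) unfolding F_def by blast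
    obtain q where q: "q \<in> C \<inter> S" "v = f q" using uv(2) unfolding F_def by blast
    have "dist p q \<le> diameter C"
      using diameter_bounded_bound[OF assms(1)] p(1) q(1) by simp
    then show ?thesis using f[OF p(1) q(1)] p(2) q(2) by linarith
  qed
  obtain w where w: "w \<in> F" using ne by blast
  have bdd: "bdd_above F" "bdd_below F"
  proof -
    show "bdd_above F" using *[OF _ w] by (intro bdd_aboveI[of _ "w + diameter C"]) (simp add: algebra_simps)
    show "bdd_below F" using *[OF w] by (intro bdd_belowI[of _ "w - diameter C"]) (simp add: algebra_simps)
  qed
  have sub: "F \<subseteq> {Inf F..Sup F}" using bdd by (auto intro: cInf_lower cSup_upper)
  have "Sup F \<le> Inf F + diameter C"
  proof (rule cSup_least[OF ne])
    fix u assume u: "u \<in> F"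
    have "u - diameter C \<le> Inf F"
      using *[OF u] by (intro cInf_greatest[OF ne]) (simp add: algebra_simps)
    then show "u \<le> Inf F + diameter C" by simp
  qed
  then show ?thesis using that[of "Inf F" "Sup F"] sub w by (auto simp: F_def)
qed

lemma emeasure_le_hausdorff_premeasure_1:
  fixes f :: "'a::metric_space \<Rightarrow> real"
  assumes "S \<subseteq> A" "K \<in> sets borel" "K \<subseteq> f ` S"
    and f: "\<And>p q. p \<in> S \<Longrightarrow> q \<in> S \<Longrightarrow> dist p q \<le> d \<Longrightarrow> \<bar>f p - f q\<bar> \<le> dist p q"
  shows "emeasure lborel K \<le> hausdorff_premeasure 1 d A"
  unfolding hausdorff_premeasure_def
proof (rule INF_greatest)
  fix C :: "nat \<Rightarrow> 'a set"
  assume "C \<in> {C. A \<subseteq> (\<Union>i. C i) \<and> (\<forall>i. bounded (C i) \<and> diameter (C i) \<le> d)}"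
  then have cov: "A \<subseteq> (\<Union>i. C i)" and bd: "\<And>i. bounded (C i)" and dm: "\<And>i. diameter (C i) \<le> d"
    by auto
  have "\<exists>D. D \<in> sets borel \<and> f ` (C i \<inter> S) \<subseteq> D \<and> emeasure lborel D \<le> hausdorff_weight 1 (C i)" for i
  proof (cases "C i = {}")
    case True
    then show ?thesis by (intro exI[of _ "{}"]) (simp add: hausdorff_weight_1)
  next
    case False
    have "\<bar>f p - f q\<bar> \<le> dist p q" if "p \<in> C i \<inter> S" "q \<in> C i \<inter> S" for p q
      using diameter_bounded_bound[OF bd, of p i q] dm[of i] f[of p q] that by auto
    then obtain a b where "f ` (C i \<inter> S) \<subseteq> {a..b}" "a \<le> b" "b - a \<le> diameter (C i)"
      using image_subset_interval_diameter[OF bd False] by metis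
    then show ?thesis
      using False by (intro exI[of _ "{a..b}"]) (simp add: hausdorff_weight_1[unfolded One_nat_def] ennreal_leI)
  qed
  then obtain D where D: "\<And>i. D i \<in> sets borel" "\<And>i. f ` (C i \<inter> S) \<subseteq> D i"
      "\<And>i. emeasure lborel (D i) \<le> hausdorff_weight 1 (C i)"
    by metis
  have "K \<subseteq> (\<Union>i. D i)"
  proof
    fix t assume "t \<in> K"
    then obtain p where p: "p \<in> S" "t = f p" using assms(3) by blast
    then obtain i where "p \<in> C i" using assms(1) cov by blast
    then show "t \<in> (\<Union>i. D i)" using p D(2) by blast
  qed
  then have "emeasure lborel K \<le> emeasure lborel (\<Union>i. D i)"
    using D(1) by (intro emeasure_mono) auto
  also have "\<dots> \<le> (\<Sum>i. emeasure lborel (D i))"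
    using D(1) by (intro emeasure_subadditive_countably) auto
  also have "\<dots> \<le> (\<Sum>i. hausdorff_weight 1 (C i))"
    using D(3) by (intro suminf_le) auto
  finally show "emeasure lborel K \<le> (\<Sum>i. hausdorff_weight 1 (C i))" .
qed

lemma hausdorff_premeasure_le_measure:
  "d > 0 \<Longrightarrow> hausdorff_premeasure j d A \<le> hausdorff_measure j A"
  unfolding hausdorff_measure_def by (rule SUP_upper) simp

section \<open>Geometry of the lines\<close>

text \<open>The sign of \<open>m\<close> merges the two families: the line of slope \<delta>/n has
  \<open>m = n\<close>, the one of slope -\<delta>/n has \<open>m = -n\<close>.\<close>

lemma Lambda_eq:
  "Lambda \<delta> = {p. \<exists>m::int. m \<noteq> 0 \<and> of_int m * p $ 2 = \<delta> * p $ 1}"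
proof (intro set_eqI iffI)
  fix p assume "p \<in> Lambda \<delta>"
  then obtain n :: nat and x where n: "n \<ge> 1"
    and "p = vector [x, \<delta> * x / real n] \<or> p = vector [x, - (\<delta> * x / real n)]"
    unfolding Lambda_def by auto
  then show "p \<in> {p. \<exists>m::int. m \<noteq> 0 \<and> of_int m * p $ 2 = \<delta> * p $ 1}"
  proof (elim disjE)
    assume "p = vector [x, \<delta> * x / real n]"
    then show ?thesis using n by (auto intro!: exI[of _ "int n"])
  next
    assume "p = vector [x, - (\<delta> * x / real n)]"
    then show ?thesis using n by (auto intro!: exI[of _ "- int n"])
  qed
next
  fix p :: "real^2" assume "p \<in> {p. \<exists>m::int. m \<noteq> 0 \<and> of_int m * p $ 2 = \<delta> * p $ 1}"
  then obtain m :: int where m: "m \<noteq> 0" "of_int m * p $ 2 = \<delta> * p $ 1" by auto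
  define n where "n = nat \<bar>m\<bar>"
  have n: "n \<ge> 1" "real n = \<bar>of_int m\<bar>" using m(1) by (auto simp: n_def)
  have p2: "p $ 2 = \<delta> * p $ 1 / of_int m" using m by (simp add: field_simps)
  have "p = vector [p $ 1, \<delta> * p $ 1 / real n] \<or> p = vector [p $ 1, - (\<delta> * p $ 1 / real n)]"
    using n(2) p2 by (cases "m > 0") (auto simp: vec_eq_iff forall_2)
  then show "p \<in> Lambda \<delta>" unfolding Lambda_def using n(1) by blast
qed

text \<open>The linear form \<open>of_int k * y - \<delta> * x\<close> vanishes at \<open>q\<close>,
  so at \<open>p\<close> it is at most a multiple of \<open>dist p q\<close>. At \<open>p\<close> it
  also equals \<open>(k - m) * p $ 2\<close>, which bounds it from below. The constant depends on
  \<open>k\<close> alone, so the gap is uniform over the infinitely many lines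
  \<open>m\<close>.\<close>

lemma lines_gap:
  fixes p q :: "real^2" and m k :: int
  assumes "\<delta> > 0" "m \<noteq> k" "m \<noteq> 0"
    and p: "of_int m * p $ 2 = \<delta> * p $ 1" and q: "of_int k * q $ 2 = \<delta> * q $ 1"
  shows "\<delta> * \<bar>p $ 1\<bar> \<le> (\<bar>of_int k\<bar> + 1) * (\<bar>of_int k\<bar> + \<delta>) * dist p q"
proof -
  \<comment> \<open>Triangle inequality, with distinct integers being at least 1 apart.\<close>
  have "\<bar>m\<bar> \<le> (\<bar>k\<bar> + 1) * \<bar>k - m\<bar>"
  proof -
    have "\<bar>k\<bar> * 1 \<le> \<bar>k\<bar> * \<bar>k - m\<bar>" using assms(2) by (intro mult_left_mono) auto
    then show ?thesis by (simp add: algebra_simps)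
  qed
  then have "real_of_int \<bar>m\<bar> \<le> real_of_int ((\<bar>k\<bar> + 1) * \<bar>k - m\<bar>)" by (simp only: of_int_le_iff)
  then have km: "\<bar>real_of_int m\<bar> \<le> (\<bar>of_int k\<bar> + 1) * \<bar>of_int k - of_int m\<bar>" by simp
  have comp: "\<bar>p $ i - q $ i\<bar> \<le> dist p q" for i
    using component_le_norm_cart[of "p - q" i] by (simp add: dist_norm)
  have "\<bar>of_int k * p $ 2 - \<delta> * p $ 1\<bar> = \<bar>of_int k * (p $ 2 - q $ 2) - \<delta> * (p $ 1 - q $ 1)\<bar>"
    using q by (simp add: algebra_simps)
  also have "\<dots> \<le> \<bar>of_int k\<bar> * \<bar>p $ 2 - q $ 2\<bar> + \<delta> * \<bar>p $ 1 - q $ 1\<bar>"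
    using assms(1) by (metis abs_mult abs_of_pos abs_triangle_ineq4)
  also have "\<dots> \<le> \<bar>of_int k\<bar> * dist p q + \<delta> * dist p q"
    using assms(1) comp by (intro add_mono mult_left_mono) auto
  finally have up: "\<bar>of_int k * p $ 2 - \<delta> * p $ 1\<bar> \<le> (\<bar>of_int k\<bar> + \<delta>) * dist p q"
    by (simp add: algebra_simps)
  have "\<delta> * \<bar>p $ 1\<bar> = \<bar>of_int m\<bar> * \<bar>p $ 2\<bar>"
    using p assms(1) by (metis abs_mult abs_of_pos)
  also have "\<dots> \<le> (\<bar>of_int k\<bar> + 1) * \<bar>of_int k - of_int m\<bar> * \<bar>p $ 2\<bar>"
    using km by (intro mult_right_mono) auto
  also have "\<dots> = (\<bar>of_int k\<bar> + 1) * \<bar>of_int k * p $ 2 - \<delta> * p $ 1\<bar>"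
    using p by (simp add: abs_mult[symmetric] left_diff_distrib)
  also have "\<dots> \<le> (\<bar>of_int k\<bar> + 1) * ((\<bar>of_int k\<bar> + \<delta>) * dist p q)"
    using up by (intro mult_left_mono) auto
  finally show ?thesis by (simp add: mult.assoc)
qed

text \<open>\<open>L\<close> is the hyperplane orthogonal to the nonzero vector (a, -b), hence of
  dimension 2 - 1.\<close>

lemma line_through_origin:
  fixes a b :: real
  assumes "a \<noteq> 0 \<or> b \<noteq> 0"
  defines "L \<equiv> {p :: real^2. b * p $ 2 = a * p $ 1}"
  shows "affine L" "aff_dim L = 1"
proof -
  have L: "L = {p. vector [a, - b] \<bullet> p = 0}"
    by (auto simp: L_def inner_vec_def sum_2)
  have "(vector [a, - b] :: real^2) \<noteq> 0"
    using assms(1) by (auto simp: vec_eq_iff forall_2)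
  then show "affine L" "aff_dim L = 1"
    unfolding L by (auto intro: affine_hyperplane)
qed

section \<open>The approximation property\<close>

lemma strong_approx_property_Lambda:
  assumes "\<delta> > 0"
  shows "strong_approx_property 1 \<delta> (Lambda \<delta>)"
  unfolding strong_approx_property_def
proof
  fix q assume "q \<in> Lambda \<delta>"
  then obtain k :: int where k: "k \<noteq> 0" "of_int k * q $ 2 = \<delta> * q $ 1"
    by (auto simp: Lambda_eq)
  show "\<exists>L r. affine L \<and> aff_dim L = int 1 \<and> q \<in> L \<and> r > 0 \<and>
      (\<forall>\<rho>\<in>{0<..r}. ball q \<rho> \<inter> Lambda \<delta> \<subseteq> nbhd L (\<delta> * \<rho>))"
  proof (cases "q $ 1 = 0")
    case True
    then have q0: "q = 0" using k by (auto simp: vec_eq_iff forall_2)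
    \<comment> \<open>The horizontal axis, written with coefficients so as to match
      \<open>line_through_origin\<close>.\<close>
    define L where "L = {p :: real^2. 1 * p $ 2 = 0 * p $ 1}"
    have "ball q \<rho> \<inter> Lambda \<delta> \<subseteq> nbhd L (\<delta> * \<rho>)" for \<rho>
    proof
      fix p assume p: "p \<in> ball q \<rho> \<inter> Lambda \<delta>"
      then obtain m :: int where m: "m \<noteq> 0" "of_int m * p $ 2 = \<delta> * p $ 1"
        by (auto simp: Lambda_eq)
      have "1 * \<bar>p $ 2\<bar> \<le> \<bar>of_int m\<bar> * \<bar>p $ 2\<bar>"
        using m(1) by (intro mult_right_mono) (simp_all add: abs_if)
      also have "\<dots> = \<delta> * \<bar>p $ 1\<bar>"
        using m(2) assms by (metis abs_mult abs_of_pos)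
      also have "\<dots> \<le> \<delta> * norm p"
        using assms component_le_norm_cart[of p 1] by simp
      also have "\<dots> < \<delta> * \<rho>" using p q0 assms by simp
      finally have "\<bar>p $ 2\<bar> < \<delta> * \<rho>" by simp
      moreover have "norm (p - vector [p $ 1, 0]) \<le> \<bar>p $ 2\<bar>"
        using norm_le_l1_cart[of "p - vector [p $ 1, 0]"] by (simp add: sum_2)
      moreover have "vector [p $ 1, 0] \<in> L" by (simp add: L_def)
      ultimately show "p \<in> nbhd L (\<delta> * \<rho>)" unfolding nbhd_def
        by (auto intro: le_less_trans)
    qed
    moreover have "affine L" "aff_dim L = 1" unfolding L_def by (rule line_through_origin; simp)+
    moreover have "q \<in> L" by (simp add: q0 L_def)
    \<comment> \<open>The inclusion holds at every scale, so the radius 1 is arbitrary.\<close>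
    ultimately show ?thesis by (intro exI[of _ L] exI[of _ 1]) auto
  next
    case False
    define L where "L = {p :: real^2. of_int k * p $ 2 = \<delta> * p $ 1}"
    define B where "B = (\<bar>real_of_int k\<bar> + 1) * (\<bar>of_int k\<bar> + \<delta>)"
    \<comment> \<open>The first bound keeps \<bar>p $ 1\<bar> above half of \<bar>q $ 1\<bar>; the
      second makes \<open>lines_gap\<close> push it below that half if \<open>p\<close> lies on
      another line.\<close>
    define r where "r = min (\<bar>q $ 1\<bar> / 2) (\<delta> * \<bar>q $ 1\<bar> / (2 * B))"
    have B: "B > 0" using assms by (auto simp: B_def intro!: mult_pos_pos add_nonneg_pos)
    have r: "r > 0" using False assms B by (simp add: r_def)
    have "ball q \<rho> \<inter> Lambda \<delta> \<subseteq> nbhd L (\<delta> * \<rho>)" if \<rho>: "\<rho> \<in> {0<..r}" for \<rho>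
    proof
      fix p assume p: "p \<in> ball q \<rho> \<inter> Lambda \<delta>"
      then obtain m :: int where m: "m \<noteq> 0" "of_int m * p $ 2 = \<delta> * p $ 1"
        by (auto simp: Lambda_eq)
      have d: "dist p q < r" using p \<rho> by (auto simp: dist_commute)
      have "m = k"
      proof (rule ccontr)
        assume "m \<noteq> k"
        then have "\<delta> * \<bar>p $ 1\<bar> \<le> B * dist p q"
          unfolding B_def by (rule lines_gap[OF assms _ m(1) m(2) k(2)])
        also have "\<dots> < B * r" using B d by simp
        also have "\<dots> \<le> B * (\<delta> * \<bar>q $ 1\<bar> / (2 * B))"
          using B by (intro mult_left_mono) (auto simp: r_def)
        also have "\<dots> = \<delta> * (\<bar>q $ 1\<bar> / 2)" using B by simp
        finally have "\<bar>p $ 1\<bar> < \<bar>q $ 1\<bar> / 2" using assms by simp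
        moreover have "\<bar>p $ 1 - q $ 1\<bar> < \<bar>q $ 1\<bar> / 2"
          using component_le_norm_cart[of "p - q" 1] d by (simp add: dist_norm r_def)
        ultimately show False by linarith
      qed
      then have "p \<in> L" using m by (simp add: L_def)
      then show "p \<in> nbhd L (\<delta> * \<rho>)" using \<rho> assms by (auto simp: nbhd_def intro!: bexI[of _ p])
    qed
    moreover have "affine L" "aff_dim L = 1"
      unfolding L_def using assms by (intro line_through_origin; simp)+
    moreover have "q \<in> L" using k by (simp add: L_def)
    ultimately show ?thesis using r by (intro exI[of _ L] exI[of _ r]) auto
  qed
qed

section \<open>Infinite measure near the origin\<close>

lemma hausdorff_measure_ball_Lambda_ge:
  assumes "\<delta> > 0" "\<rho> > 0"
  shows "ennreal (real N * (\<rho> / (1 + \<delta>) / 2)) \<le> hausdorff_measure 1 (ball 0 \<rho> \<inter> Lambda \<delta>)"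
proof -
  \<comment> \<open>On the lines used, the norm of \<open>p\<close> is at most
    \<open>(1 + \<delta>) * p $ 1\<close>, so \<open>p $ 1 < c\<close> keeps \<open>p\<close> in the
    ball.\<close>
  define c where "c = \<rho> / (1 + \<delta>)"
  have c: "c > 0" and c\<rho>: "c * (1 + \<delta>) = \<rho>" using assms by (simp_all add: c_def)
  define S where "S = {p :: real^2. c / 2 \<le> p $ 1 \<and> p $ 1 < c \<and>
    (\<exists>m::int. 1 \<le> m \<and> m \<le> int N \<and> of_int m * p $ 2 = \<delta> * p $ 1)}"
  \<comment> \<open>On the line \<open>m y = \<delta> x\<close> the quotient below equals \<open>m\<close>, so the piece on that line is shifted
    by \<open>m c / 2\<close>.\<close>
  define f where "f p = \<delta> * p $ 1 / p $ 2 * (c / 2) + p $ 1" for p :: "real^2"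
  have f_eq: "f p = of_int m * (c / 2) + p $ 1"
    if "of_int m * p $ 2 = \<delta> * p $ 1" "c / 2 \<le> p $ 1" for p and m :: int
  proof -
    have "\<delta> * p $ 1 \<noteq> 0" using that(2) c assms(1) by simp
    then have "p $ 2 \<noteq> 0" using that(1) by auto
    then show ?thesis unfolding f_def that(1)[symmetric] by simp
  qed
  \<comment> \<open>\<open>B\<close> dominates the constants of \<open>lines_gap\<close> for all the
    lines up to \<open>N\<close>. The scale \<open>d\<close> makes \<open>B * d\<close> half of
    \<open>\<delta> * c / 2\<close>, the least value of \<open>\<delta> * p $ 1\<close> on
    \<open>S\<close>.\<close>
  define B where "B = (real N + 1) * (real N + \<delta>)"
  have B: "B > 0" using assms by (auto simp: B_def intro!: mult_pos_pos add_nonneg_pos)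
  define d where "d = \<delta> * c / (4 * B)"
  have d: "d > 0" using B c assms by (simp add: d_def)
  have lip: "\<bar>f p - f q\<bar> \<le> dist p q" if pS: "p \<in> S" and qS: "q \<in> S" and pq: "dist p q \<le> d" for p q
  proof -
    obtain m :: int where m: "1 \<le> m" "m \<le> int N" "of_int m * p $ 2 = \<delta> * p $ 1"
      using pS by (auto simp: S_def)
    obtain k :: int where k: "1 \<le> k" "k \<le> int N" "of_int k * q $ 2 = \<delta> * q $ 1"
      using qS by (auto simp: S_def)
    have x: "c / 2 \<le> p $ 1" "c / 2 \<le> q $ 1" using pS qS by (auto simp: S_def)
    have "m = k"
    proof (rule ccontr)
      assume "m \<noteq> k"
      have kN: "\<bar>real_of_int k\<bar> \<le> real N" using k(1,2) by linarith
      have "\<delta> * (c / 2) \<le> \<delta> * \<bar>p $ 1\<bar>" using x(1) assms(1) by (intro mult_left_mono) auto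
      also have "\<dots> \<le> (\<bar>of_int k\<bar> + 1) * (\<bar>of_int k\<bar> + \<delta>) * dist p q"
        using m(1) by (intro lines_gap[OF assms(1) \<open>m \<noteq> k\<close> _ m(3) k(3)]) auto
      also have "\<dots> \<le> B * d"
        unfolding B_def using kN pq assms(1) by (intro mult_mono) auto
      also have "\<dots> = \<delta> * (c / 4)" using B by (simp add: d_def)
      finally show False using assms(1) c by simp
    qed
    then have "\<bar>f p - f q\<bar> = \<bar>(p - q) $ 1\<bar>"
      using f_eq[OF m(3) x(1)] f_eq[OF k(3) x(2)] by simp
    then show ?thesis using component_le_norm_cart[of "p - q" 1] by (simp add: dist_norm)
  qed
  have SL: "S \<subseteq> ball 0 \<rho> \<inter> Lambda \<delta>"
  proof
    fix p assume pS: "p \<in> S"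
    then obtain m :: int where m: "1 \<le> m" "of_int m * p $ 2 = \<delta> * p $ 1"
      by (auto simp: S_def)
    have x: "0 < p $ 1" "p $ 1 < c" using pS c by (auto simp: S_def)
    have "1 * \<bar>p $ 2\<bar> \<le> \<bar>of_int m\<bar> * \<bar>p $ 2\<bar>"
      using m(1) by (intro mult_right_mono) auto
    also have "\<dots> = \<delta> * \<bar>p $ 1\<bar>" using m(2) assms(1) by (metis abs_mult abs_of_pos)
    finally have "norm p \<le> p $ 1 * (1 + \<delta>)"
      using norm_le_l1_cart[of p] x(1) by (simp add: sum_2 algebra_simps)
    also have "\<dots> < c * (1 + \<delta>)" using x(2) assms(1) by simp
    finally have "norm p < \<rho>" using c\<rho> by simp
    moreover have "m \<noteq> 0" using m(1) by simp
    ultimately show "p \<in> ball 0 \<rho> \<inter> Lambda \<delta>"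
      using m(2) by (auto simp: Lambda_eq)
  qed
  \<comment> \<open>The piece on line \<open>m\<close> is sent onto the half-open interval from
    \<open>(m + 1) * (c / 2)\<close> to \<open>(m + 2) * (c / 2)\<close>; for \<open>m\<close> from
    1 to \<open>N\<close> these tile the interval on the left.\<close>
  have "{c..<c + real N * (c / 2)} \<subseteq> f ` S"
  proof
    fix t assume t: "t \<in> {c..<c + real N * (c / 2)}"
    \<comment> \<open>The index of the tile containing \<open>t\<close>; the shift by 1 arises
      because the pieces start at \<open>c / 2\<close> rather than 0.\<close>
    define m where "m = \<lfloor>t / (c / 2)\<rfloor> - 1"
    define x where "x = t - of_int m * (c / 2)"
    have lo: "(of_int m + 1) * (c / 2) \<le> t" and hi: "t < (of_int m + 2) * (c / 2)"
    proof -
      have "of_int m + 1 \<le> t / (c / 2)" "t / (c / 2) < of_int m + 2"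
        unfolding m_def by linarith+
      then show "(of_int m + 1) * (c / 2) \<le> t" "t < (of_int m + 2) * (c / 2)"
        using c by (simp_all add: pos_le_divide_eq pos_divide_less_eq)
    qed
    have "(2::real) * (c / 2) < (of_int m + 2) * (c / 2)" using hi t by simp
    then have "(2::real) < of_int m + 2" using c by simp
    then have m1: "1 \<le> m" by simp
    have "(of_int m + 1) * (c / 2) < (real N + 2) * (c / 2)" using lo t by (simp add: algebra_simps)
    then have "of_int m + 1 < real N + 2" using c by simp
    then have mN: "m \<le> int N" by linarith
    have x: "c / 2 \<le> x" "x < c" using lo hi by (simp_all add: x_def algebra_simps)
    define p :: "real^2" where "p = vector [x, \<delta> * x / of_int m]"
    have pm: "of_int m * p $ 2 = \<delta> * p $ 1" and px: "p $ 1 = x"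
      using m1 by (simp_all add: p_def)
    have "p \<in> S" using pm px x m1 mN by (auto simp: S_def)
    moreover have "f p = t" using f_eq[OF pm] px x by (simp add: x_def)
    ultimately show "t \<in> f ` S" by blast
  qed
  then have "emeasure lborel {c..<c + real N * (c / 2)} \<le> hausdorff_premeasure 1 d (ball 0 \<rho> \<inter> Lambda \<delta>)"
    using lip by (intro emeasure_le_hausdorff_premeasure_1[OF SL]) auto
  \<comment> \<open>The measure is a supremum over scales, so the bound at the single scale
    \<open>d\<close>, which depends on \<open>N\<close>, is enough.\<close>
  also have "\<dots> \<le> hausdorff_measure 1 (ball 0 \<rho> \<inter> Lambda \<delta>)"
    using d by (rule hausdorff_premeasure_le_measure)
  finally show ?thesis using c unfolding c_def[symmetric] by simp
qed

text \<open>In any ball around the origin the lower bound grows linearly in \<open>N\<close> with a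
  fixed positive slope, so it exceeds every finite value.\<close>

lemma not_weak_locally_finite_Lambda:
  assumes "\<delta> > 0"
  shows "\<not> weak_locally_finite_hausdorff 1 (Lambda \<delta>)"
proof
  assume "weak_locally_finite_hausdorff 1 (Lambda \<delta>)"
  moreover have "0 \<in> Lambda \<delta>" by (auto simp: Lambda_eq intro!: exI[of _ 1])
  ultimately obtain \<rho> where \<rho>: "\<rho> > 0" "hausdorff_measure 1 (ball 0 \<rho> \<inter> Lambda \<delta>) < \<infinity>"
    unfolding weak_locally_finite_hausdorff_def by blast
  then obtain M where M: "M \<ge> 0" "hausdorff_measure 1 (ball 0 \<rho> \<inter> Lambda \<delta>) = ennreal M"
    by (cases "hausdorff_measure 1 (ball 0 \<rho> \<inter> Lambda \<delta>)") auto
  define h where "h = \<rho> / (1 + \<delta>) / 2"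
  have h: "h > 0" using \<rho>(1) assms by (simp add: h_def)
  obtain N :: nat where N: "M < real N * h" using reals_Archimedean3[OF h] by blast
  have "ennreal (real N * h) \<le> ennreal M"
    using hausdorff_measure_ball_Lambda_ge[OF assms \<rho>(1)] M(2) unfolding h_def by metis
  then show False using N M(1) by (simp add: ennreal_le_iff)
qed

theorem proposition5p1:
  fixes \<delta> :: real
  assumes "\<delta> > 0"
  shows "strong_approx_property 1 \<delta> (Lambda \<delta>)
    \<and> \<not> weak_locally_finite_hausdorff 1 (Lambda \<delta>)
    \<and> \<not> (\<forall>A :: (real^2) set. strong_approx_property 1 \<delta> A \<longrightarrow> weak_locally_finite_hausdorff 1 A)"
  using strong_approx_property_Lambda[OF assms] not_weak_locally_finite_Lambda[OF assms] by blast

end
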